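(* Let $X$ be a small category. Any idempotent $e:\mathbf{e}\to X$ in $X$ is an atom in $\mathbf{Cat}/X$.
   Context: $\mathbf{Cat}/X$ is the slice category: objects are functors $\pi:P\to X$ with $P$ small, morphisms are functors commuting with the projections to $X$; $\hom(P,Q)$ is the set of morphisms. $\mathrm{ten}(P,Q)$ is the set of connected components of the product $P\times Q$ in $\mathbf{Cat}/X$ (the pullback $P\times_XQ$). A discrete fibration over $X$ is a $\pi:A\to X$ such that for every object $a$ of $A$ and arrow $f:y\to\pi a$ of $X$ there is a unique arrow of $A$ with codomain $a$ over $f$; discrete opfibrations are defined dually. $P\in\mathbf{Cat}/X$ is a left atom if there are bijections $\mathrm{ten}(P,A)\cong\hom(P,A)$ natural in $A$ ranging over discrete fibrations over $X$; a right atom if there are bijections $\mathrm{ten}(P,D)\cong\hom(P,D)$ natural in $D$ ranging over discrete opfibrations over $X$; an atom if it is both a left and a right atom. $\mathbf{e}$ is the monoid (one-object category) whose unique non-identity arrow is idempotent; an idempotent arrow $e:x\to x$ of $X$ is the same as a functor $e:\mathbf{e}\to X$, hence an object of $\mathbf{Cat}/X$. *)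

theory Defs
  imports Main "HOL-Library.FuncSet"
begin

text \<open>Objects and arrows of a category form sets, so every category below is small.
  The operations are constrained only on these sets.\<close>

record ('o, 'a) cat =
  Ob :: "'o set"
  Ar :: "'a set"
  Dom :: "'a \<Rightarrow> 'o"
  Cod :: "'a \<Rightarrow> 'o"
  Id :: "'o \<Rightarrow> 'a"
  Comp :: "'a \<Rightarrow> 'a \<Rightarrow> 'a"  \<comment> \<open>\<open>Comp C g f\<close> is "g after f"\<close>

locale category =
  fixes C :: "('o, 'a) cat"
  assumes Dom_in: "f \<in> Ar C \<Longrightarrow> Dom C f \<in> Ob C"
    and Cod_in: "f \<in> Ar C \<Longrightarrow> Cod C f \<in> Ob C"
    and Id_in: "x \<in> Ob C \<Longrightarrow> Id C x \<in> Ar C"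
    and Dom_Id: "x \<in> Ob C \<Longrightarrow> Dom C (Id C x) = x"
    and Cod_Id: "x \<in> Ob C \<Longrightarrow> Cod C (Id C x) = x"
    and Comp_in: "\<lbrakk>f \<in> Ar C; g \<in> Ar C; Cod C f = Dom C g\<rbrakk> \<Longrightarrow> Comp C g f \<in> Ar C"
    and Dom_Comp: "\<lbrakk>f \<in> Ar C; g \<in> Ar C; Cod C f = Dom C g\<rbrakk> \<Longrightarrow> Dom C (Comp C g f) = Dom C f"
    and Cod_Comp: "\<lbrakk>f \<in> Ar C; g \<in> Ar C; Cod C f = Dom C g\<rbrakk> \<Longrightarrow> Cod C (Comp C g f) = Cod C g"
    and Comp_Id_right: "f \<in> Ar C \<Longrightarrow> Comp C f (Id C (Dom C f)) = f"
    and Comp_Id_left: "f \<in> Ar C \<Longrightarrow> Comp C (Id C (Cod C f)) f = f"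
    and Comp_assoc: "\<lbrakk>f \<in> Ar C; g \<in> Ar C; h \<in> Ar C; Cod C f = Dom C g; Cod C g = Dom C h\<rbrakk>
      \<Longrightarrow> Comp C h (Comp C g f) = Comp C (Comp C h g) f"

record ('o, 'a, 'o2, 'a2) ftor =
  ob_map :: "'o \<Rightarrow> 'o2"
  ar_map :: "'a \<Rightarrow> 'a2"

locale is_functor = source: category C + target: category D
  for C :: "('o, 'a) cat" and F :: "('o, 'a, 'o2, 'a2) ftor" and D :: "('o2, 'a2) cat" +
  assumes ob_in: "x \<in> Ob C \<Longrightarrow> ob_map F x \<in> Ob D"
    and ar_in: "f \<in> Ar C \<Longrightarrow> ar_map F f \<in> Ar D"
    and map_Dom: "f \<in> Ar C \<Longrightarrow> Dom D (ar_map F f) = ob_map F (Dom C f)"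
    and map_Cod: "f \<in> Ar C \<Longrightarrow> Cod D (ar_map F f) = ob_map F (Cod C f)"
    and map_Id: "x \<in> Ob C \<Longrightarrow> ar_map F (Id C x) = Id D (ob_map F x)"
    and map_Comp: "\<lbrakk>f \<in> Ar C; g \<in> Ar C; Cod C f = Dom C g\<rbrakk>
      \<Longrightarrow> ar_map F (Comp C g f) = Comp D (ar_map F g) (ar_map F f)"

record ('o, 'a, 'x, 'y) over =
  tot :: "('o, 'a) cat"
  proj :: "('o, 'a, 'x, 'y) ftor"

definition slice :: "('x, 'y) cat \<Rightarrow> ('o, 'a, 'x, 'y) over set" where
  "slice X = {P. is_functor (tot P) (proj P) X}"

text \<open>The two maps of a morphism are normalised to \<open>undefined\<close> off the source category,
  so that equality in \<open>hom P Q\<close> is equality of functors.\<close>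

definition hom :: "('o, 'a, 'x, 'y) over \<Rightarrow> ('o2, 'a2, 'x, 'y) over
    \<Rightarrow> ('o, 'a, 'o2, 'a2) ftor set" where
  "hom P Q = {F. is_functor (tot P) F (tot Q)
     \<and> ob_map F \<in> extensional (Ob (tot P)) \<and> ar_map F \<in> extensional (Ar (tot P))
     \<and> (\<forall>p \<in> Ob (tot P). ob_map (proj Q) (ob_map F p) = ob_map (proj P) p)
     \<and> (\<forall>f \<in> Ar (tot P). ar_map (proj Q) (ar_map F f) = ar_map (proj P) f)}"

definition comp_hom :: "('o, 'a, 'x, 'y) over \<Rightarrow> ('o2, 'a2, 'o3, 'a3) ftor
    \<Rightarrow> ('o, 'a, 'o2, 'a2) ftor \<Rightarrow> ('o, 'a, 'o3, 'a3) ftor" where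
  "comp_hom P G F =
     \<lparr>ob_map = compose (Ob (tot P)) (ob_map G) (ob_map F),
      ar_map = compose (Ar (tot P)) (ar_map G) (ar_map F)\<rparr>"

definition pullback :: "('o, 'a, 'x, 'y) over \<Rightarrow> ('o2, 'a2, 'x, 'y) over
    \<Rightarrow> ('o \<times> 'o2, 'a \<times> 'a2) cat" where
  "pullback P Q =
     \<lparr>Ob = {(p, q). p \<in> Ob (tot P) \<and> q \<in> Ob (tot Q)
              \<and> ob_map (proj P) p = ob_map (proj Q) q},
      Ar = {(f, g). f \<in> Ar (tot P) \<and> g \<in> Ar (tot Q)
              \<and> ar_map (proj P) f = ar_map (proj Q) g},
      Dom = map_prod (Dom (tot P)) (Dom (tot Q)),
      Cod = map_prod (Cod (tot P)) (Cod (tot Q)),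
      Id = map_prod (Id (tot P)) (Id (tot Q)),
      Comp = (\<lambda>(f', g') (f, g). (Comp (tot P) f' f, Comp (tot Q) g' g))\<rparr>"

text \<open>The equivalence relation on objects generated by the existence of an arrow.\<close>

definition connected_rel :: "('o, 'a) cat \<Rightarrow> 'o rel" where
  "connected_rel C =
     (let R = {(Dom C f, Cod C f) | f. f \<in> Ar C} in (R \<union> R\<inverse>)\<^sup>* \<inter> (Ob C \<times> Ob C))"

definition components :: "('o, 'a) cat \<Rightarrow> 'o set set" where
  "components C = Ob C // connected_rel C"

definition ten :: "('o, 'a, 'x, 'y) over \<Rightarrow> ('o2, 'a2, 'x, 'y) over \<Rightarrow> ('o \<times> 'o2) set set" where
  "ten P Q = components (pullback P Q)"

text \<open>The map \<open>ten P A \<rightarrow> ten P B\<close> induced by \<open>F : A \<rightarrow> B\<close>: the component of \<open>(p, a)\<close> goes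
  to the component of \<open>(p, F a)\<close>.\<close>

definition ten_map :: "('o, 'a, 'x, 'y) over \<Rightarrow> ('o3, 'a3, 'x, 'y) over
    \<Rightarrow> ('o2, 'a2, 'o3, 'a3) ftor \<Rightarrow> ('o \<times> 'o2) set \<Rightarrow> ('o \<times> 'o3) set" where
  "ten_map P B F t = connected_rel (pullback P B) `` (map_prod id (ob_map F) ` t)"

definition discrete_fibrations :: "('x, 'y) cat \<Rightarrow> ('o, 'a, 'x, 'y) over set" where
  "discrete_fibrations X = {A \<in> slice X.
     \<forall>a \<in> Ob (tot A). \<forall>f \<in> Ar X. Cod X f = ob_map (proj A) a \<longrightarrow>
       (\<exists>!g. g \<in> Ar (tot A) \<and> Cod (tot A) g = a \<and> ar_map (proj A) g = f)}"

definition discrete_opfibrations :: "('x, 'y) cat \<Rightarrow> ('o, 'a, 'x, 'y) over set" where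
  "discrete_opfibrations X = {A \<in> slice X.
     \<forall>a \<in> Ob (tot A). \<forall>f \<in> Ar X. Dom X f = ob_map (proj A) a \<longrightarrow>
       (\<exists>!g. g \<in> Ar (tot A) \<and> Dom (tot A) g = a \<and> ar_map (proj A) g = f)}"

definition natural_bijections ::
  "('p, 'q, 'x, 'y) over \<Rightarrow> ('o, 'a, 'x, 'y) over set
    \<Rightarrow> (('o, 'a, 'x, 'y) over \<Rightarrow> ('p \<times> 'o) set \<Rightarrow> ('p, 'q, 'o, 'a) ftor) \<Rightarrow> bool" where
  "natural_bijections P \<A> \<phi> \<longleftrightarrow>
     (\<forall>A \<in> \<A>. bij_betw (\<phi> A) (ten P A) (hom P A)) \<and>
     (\<forall>A \<in> \<A>. \<forall>B \<in> \<A>. \<forall>F \<in> hom A B. \<forall>t \<in> ten P A.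
        \<phi> B (ten_map P B F t) = comp_hom P F (\<phi> A t))"

text \<open>HOL cannot quantify over all types inside a definition, so the types \<open>'o\<close> and \<open>'a\<close> from
  which the test categories draw their objects and arrows are parameters.\<close>

definition left_atom :: "'o itself \<Rightarrow> 'a itself \<Rightarrow> ('x, 'y) cat
    \<Rightarrow> ('p, 'q, 'x, 'y) over \<Rightarrow> bool" where
  "left_atom TO TA X P \<longleftrightarrow> P \<in> slice X \<and>
     (\<exists>\<phi>. natural_bijections P (discrete_fibrations X :: ('o, 'a, 'x, 'y) over set) \<phi>)"

definition right_atom :: "'o itself \<Rightarrow> 'a itself \<Rightarrow> ('x, 'y) cat
    \<Rightarrow> ('p, 'q, 'x, 'y) over \<Rightarrow> bool" where
  "right_atom TO TA X P \<longleftrightarrow> P \<in> slice X \<and>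
     (\<exists>\<phi>. natural_bijections P (discrete_opfibrations X :: ('o, 'a, 'x, 'y) over set) \<phi>)"

definition atom :: "'o itself \<Rightarrow> 'a itself \<Rightarrow> ('x, 'y) cat
    \<Rightarrow> ('p, 'q, 'x, 'y) over \<Rightarrow> bool" where
  "atom TO TA X P \<longleftrightarrow> left_atom TO TA X P \<and> right_atom TO TA X P"

datatype e_arrow = E_one | E_idem

definition e_cat :: "(unit, e_arrow) cat" where
  "e_cat = \<lparr>Ob = UNIV, Ar = UNIV, Dom = (\<lambda>_. ()), Cod = (\<lambda>_. ()), Id = (\<lambda>_. E_one),
     Comp = (\<lambda>g f. if g = E_one then f else E_idem)\<rparr>"

lemma category_e_cat: "category e_cat"
  by unfold_locales (auto simp: e_cat_def intro: e_arrow.exhaust)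

text \<open>Functors \<open>e_cat \<rightarrow> X\<close> are the same as idempotent arrows of \<open>X\<close>.\<close>

lemma is_functor_e_cat_iff:
  assumes "category X"
  shows "is_functor e_cat F X \<longleftrightarrow>
    (let x = ob_map F (); e = ar_map F E_idem in
      x \<in> Ob X \<and> ar_map F E_one = Id X x \<and>
      e \<in> Ar X \<and> Dom X e = x \<and> Cod X e = x \<and> Comp X e e = e)"
    (is "?L \<longleftrightarrow> ?R")
proof
  assume ?L
  then interpret is_functor e_cat F X .
  show ?R
    using ob_in[of "()"] map_Id[of "()"] ar_in[of E_idem] map_Dom[of E_idem]
      map_Cod[of E_idem] map_Comp[of E_idem E_idem]
    by (simp add: e_cat_def)
next
  assume R: ?R
  interpret category X by fact
  note R' = R[unfolded Let_def]
  have ar: "ar_map F f \<in> Ar X \<and> Dom X (ar_map F f) = ob_map F ()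
      \<and> Cod X (ar_map F f) = ob_map F ()" for f
    using R' Id_in Dom_Id Cod_Id by (cases f) auto
  have comp: "ar_map F (if g = E_one then f else E_idem) = Comp X (ar_map F g) (ar_map F f)"
    for f g
    using R' ar[of f] Comp_Id_left[of "ar_map F f"] Comp_Id_right[of "ar_map F g"]
    by (cases g; cases f) auto
  show ?L
    using R' ar comp category_e_cat assms
    by (auto simp: is_functor_def is_functor_axioms_def e_cat_def)
qed

end

(* A functor from e to A over X is an object a over x together with a loop at a over e.  In a
   discrete fibration, pulling back along e is an idempotent map r on the fibre over x: its fixed
   points are exactly the objects carrying such a loop, and the loop is unique.  In the product
   with e, every object a is connected to r a, and arrows only connect objects with the same image
   under r.  So each component contains the object of exactly one functor from e to A, and sending
   a component to that functor is the natural bijection.  These properties of r are self-dual, so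
   the case of opfibrations follows by passing to opposite categories. *)

theory Submission
  imports Defs
begin

section \<open>Morphisms over the base category\<close>

lemma homD:
  assumes "F \<in> hom P Q"
  shows "is_functor (tot P) F (tot Q)"
    and "p \<in> Ob (tot P) \<Longrightarrow> ob_map (proj Q) (ob_map F p) = ob_map (proj P) p"
    and "f \<in> Ar (tot P) \<Longrightarrow> ar_map (proj Q) (ar_map F f) = ar_map (proj P) f"
  using assms by (auto simp: hom_def)

lemma comp_hom_in_hom:
  assumes F: "F \<in> hom P Q" and G: "G \<in> hom Q R"
  shows "comp_hom P G F \<in> hom P R"
proof -
  interpret F: is_functor "tot P" F "tot Q" using homD(1)[OF F] .
  interpret G: is_functor "tot Q" G "tot R" using homD(1)[OF G] .
  have "is_functor (tot P) (comp_hom P G F) (tot R)"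
    by unfold_locales
      (simp_all add: comp_hom_def compose_def F.ob_in F.ar_in F.map_Dom F.map_Cod F.map_Id
        F.map_Comp G.ob_in G.ar_in G.map_Dom G.map_Cod G.map_Id G.map_Comp
        F.source.Dom_in F.source.Cod_in F.source.Id_in F.source.Comp_in)
  then show ?thesis
    using homD(2,3)[OF F] homD(2,3)[OF G] F.ob_in F.ar_in
    by (auto simp: hom_def comp_hom_def compose_eq)
qed

section \<open>Connected components and the action of morphisms on them\<close>

lemma equiv_connected_rel: "equiv (Ob C) (connected_rel C)"
proof -
  let ?S = "{(Dom C f, Cod C f) | f. f \<in> Ar C}"
  have "sym ((?S \<union> ?S\<inverse>)\<^sup>*)" by (intro sym_rtrancl sym_Un_converse)
  then show ?thesis
    unfolding connected_rel_def Let_def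
    by (intro equivI refl_onI symI transI) (auto dest: symD intro: rtrancl_trans)
qed

lemma connected_rel_arrow:
  assumes "f \<in> Ar C" "Dom C f \<in> Ob C" "Cod C f \<in> Ob C"
  shows "(Dom C f, Cod C f) \<in> connected_rel C" "(Cod C f, Dom C f) \<in> connected_rel C"
  using assms unfolding connected_rel_def Let_def by (auto intro!: r_into_rtrancl)

text \<open>Induction along a zigzag of arrows. This is the tool for telling components apart;
  \<open>k\<close> will be the retraction of a fibre.\<close>

lemma connected_rel_invariant:
  assumes "(u, v) \<in> connected_rel C"
    and "\<And>f. f \<in> Ar C \<Longrightarrow> k (Dom C f) = k (Cod C f)"
  shows "k u = k v"
proof -
  from assms(1) have "(u, v) \<in> ({(Dom C f, Cod C f) | f. f \<in> Ar C} \<union>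
      {(Dom C f, Cod C f) | f. f \<in> Ar C}\<inverse>)\<^sup>*"
    by (simp add: connected_rel_def Let_def)
  then show ?thesis by (induction rule: rtrancl_induct) (auto simp: assms(2))
qed

lemma connected_rel_map:
  assumes uv: "(u, v) \<in> connected_rel C"
    and ob: "\<And>w. w \<in> Ob C \<Longrightarrow> h w \<in> Ob D"
    and ar: "\<And>f. f \<in> Ar C \<Longrightarrow> \<exists>g \<in> Ar D. Dom D g = h (Dom C f) \<and> Cod D g = h (Cod C f)"
  shows "(h u, h v) \<in> connected_rel D"
proof -
  let ?S = "{(Dom C f, Cod C f) | f. f \<in> Ar C}" and ?T = "{(Dom D f, Cod D f) | f. f \<in> Ar D}"
  have "(h a, h b) \<in> ?T" if "(a, b) \<in> ?S" for a b
    using that ar by force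
  then have step: "(h a, h b) \<in> ?T \<union> ?T\<inverse>" if "(a, b) \<in> ?S \<union> ?S\<inverse>" for a b
    using that by blast
  have "(u, v) \<in> (?S \<union> ?S\<inverse>)\<^sup>*"
    using uv by (simp add: connected_rel_def Let_def)
  then have "(h u, h v) \<in> (?T \<union> ?T\<inverse>)\<^sup>*"
    by (induction rule: rtrancl_induct) (rule rtrancl_refl, erule rtrancl_into_rtrancl, erule step)
  then show ?thesis
    using uv ob by (auto simp: connected_rel_def Let_def)
qed

text \<open>\<open>ten_map\<close> collects the classes of the images of all members of a component.
  The images of linked members are linked by the image zigzag, so only one class arises, and any
  member may stand for its component.\<close>

lemma ten_map_class:
  assumes F: "F \<in> hom A B" and pa: "(p, a) \<in> Ob (pullback P A)"
  shows "(p, ob_map F a) \<in> Ob (pullback P B)"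
    and "ten_map P B F (connected_rel (pullback P A) `` {(p, a)}) =
      connected_rel (pullback P B) `` {(p, ob_map F a)}"
proof -
  interpret F: is_functor "tot A" F "tot B" using homD(1)[OF F] .
  let ?h = "map_prod id (ob_map F)"
  let ?R = "connected_rel (pullback P A)" and ?S = "connected_rel (pullback P B)"
  have ob: "?h w \<in> Ob (pullback P B)" if "w \<in> Ob (pullback P A)" for w
    using that F.ob_in homD(2)[OF F] by (auto simp: pullback_def)
  have ar: "\<exists>g \<in> Ar (pullback P B). Dom (pullback P B) g = ?h (Dom (pullback P A) f)
      \<and> Cod (pullback P B) g = ?h (Cod (pullback P A) f)" if "f \<in> Ar (pullback P A)" for f
    using that F.ar_in homD(3)[OF F] F.map_Dom F.map_Cod
    by (intro bexI[of _ "map_prod id (ar_map F) f"]) (auto simp: pullback_def)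
  show "(p, ob_map F a) \<in> Ob (pullback P B)" using ob[OF pa] by simp
  let ?K = "?R `` {(p, a)}"
  have map: "?S `` {?h w} = ?S `` {?h (p, a)}" if w: "w \<in> ?K" for w
  proof -
    have "((p, a), w) \<in> ?R" using w by simp
    then have "(?h (p, a), ?h w) \<in> ?S" by (rule connected_rel_map) (fact ob, fact ar)
    then show ?thesis by (rule equiv_class_eq[OF equiv_connected_rel, symmetric])
  qed
  have "ten_map P B F ?K = (\<Union>w \<in> ?K. ?S `` {?h w})"
    unfolding ten_map_def by (subst Image_eq_UN) simp
  also have "\<dots> = (\<Union>w \<in> ?K. ?S `` {?h (p, a)})"
    by (intro SUP_cong refl map)
  also have "\<dots> = ?S `` {(p, ob_map F a)}"
    using equiv_class_self[OF equiv_connected_rel pa] by (subst SUP_const) auto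
  finally show "ten_map P B F ?K = ?S `` {(p, ob_map F a)}" .
qed

section \<open>Natural bijections from unique representatives\<close>

text \<open>The inverse bijection sends \<open>F\<close> to the component of
  \<open>(p, ob_map F p)\<close>. Naturality follows from uniqueness: composing with a morphism
  moves this representative to one of the image component.\<close>

lemma natural_bijections_if_unique_representative:
  assumes p: "p \<in> Ob (tot P)"
    and uniq: "\<And>A t. A \<in> \<A> \<Longrightarrow> t \<in> ten P A \<Longrightarrow> \<exists>!F. F \<in> hom P A \<and> (p, ob_map F p) \<in> t"
  shows "natural_bijections P \<A> (\<lambda>A t. THE F. F \<in> hom P A \<and> (p, ob_map F p) \<in> t)"
    (is "natural_bijections P \<A> ?\<phi>")
  unfolding natural_bijections_def
proof (intro conjI ballI)
  fix A assume A: "A \<in> \<A>"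
  note \<phi> = theI'[OF uniq[OF A]]
  let ?R = "connected_rel (pullback P A)"
  let ?\<psi> = "\<lambda>F. ?R `` {(p, ob_map F p)}"
  have ob: "(p, ob_map F p) \<in> Ob (pullback P A)" if "F \<in> hom P A" for F
    using is_functor.ob_in[OF homD(1)[OF that]] homD(2)[OF that] p by (auto simp: pullback_def)
  have \<psi>_in: "?\<psi> F \<in> ten P A" if "F \<in> hom P A" for F
    using ob[OF that] by (auto simp: ten_def components_def intro: quotientI)
  show "bij_betw (?\<phi> A) (ten P A) (hom P A)"
  proof (rule bij_betw_byWitness[where f' = ?\<psi>])
    show "\<forall>t \<in> ten P A. ?\<psi> (?\<phi> A t) = t"
    proof
      fix t assume t: "t \<in> ten P A"
      note \<phi>t = \<phi>[OF t]
      then have "(p, ob_map (?\<phi> A t) p) \<in> ?\<psi> (?\<phi> A t)"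
        by (intro equiv_class_self[OF equiv_connected_rel] ob) blast
      \<comment> \<open>Two components that share the representative of \<open>?\<phi> A t\<close>
        coincide.\<close>
      with \<phi>t show "?\<psi> (?\<phi> A t) = t"
        using quotient_disj[OF equiv_connected_rel \<psi>_in[unfolded ten_def components_def]
            t[unfolded ten_def components_def]]
        by blast
    qed
    \<comment> \<open>\<open>F\<close> has its representative in its own component, so the unique
      choice must return it.\<close>
    show "\<forall>F \<in> hom P A. ?\<phi> A (?\<psi> F) = F"
      using the1_equality[OF uniq[OF A \<psi>_in]] equiv_class_self[OF equiv_connected_rel ob]
      by blast
    show "?\<phi> A ` ten P A \<subseteq> hom P A" using \<phi> by blast
    show "?\<psi> ` hom P A \<subseteq> ten P A" using \<psi>_in by blast
  qed
next
  fix A B F t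
  assume A: "A \<in> \<A>" and B: "B \<in> \<A>" and F: "F \<in> hom A B" and t: "t \<in> ten P A"
  note \<phi>t = theI'[OF uniq[OF A t]]
  let ?a = "ob_map (?\<phi> A t) p"
  from t obtain w where w: "t = connected_rel (pullback P A) `` {w}"
    by (auto simp: ten_def components_def elim: quotientE)
  with \<phi>t have rel: "(w, (p, ?a)) \<in> connected_rel (pullback P A)" by blast
  then have pa: "(p, ?a) \<in> Ob (pullback P A)" by (simp add: connected_rel_def Let_def)
  have t_eq: "t = connected_rel (pullback P A) `` {(p, ?a)}"
    by (rule trans[OF w equiv_class_eq[OF equiv_connected_rel rel]])
  note cls = ten_map_class[OF F pa]
  have "ten_map P B F t = connected_rel (pullback P B) `` {(p, ob_map F ?a)}"
    using cls(2) t_eq by metis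
  then have "ten_map P B F t \<in> ten P B" "(p, ob_map F ?a) \<in> ten_map P B F t"
    using cls(1) equiv_class_self[OF equiv_connected_rel cls(1)]
    by (auto simp: ten_def components_def intro: quotientI)
  then show "?\<phi> B (ten_map P B F t) = comp_hom P F (?\<phi> A t)"
    using comp_hom_in_hom[OF _ F] \<phi>t p
    by (intro the1_equality[OF uniq[OF B]]) (auto simp: comp_hom_def compose_eq)
qed

section \<open>Opposite categories\<close>

definition opp :: "('o, 'a) cat \<Rightarrow> ('o, 'a) cat" where
  "opp C = \<lparr>Ob = Ob C, Ar = Ar C, Dom = Cod C, Cod = Dom C, Id = Id C,
     Comp = (\<lambda>g f. Comp C f g)\<rparr>"

lemma opp_simps [simp]:
  "Ob (opp C) = Ob C" "Ar (opp C) = Ar C" "Dom (opp C) = Cod C" "Cod (opp C) = Dom C"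
  "Id (opp C) = Id C" "Comp (opp C) g f = Comp C f g"
  by (simp_all add: opp_def)

lemma category_opp:
  assumes "category C"
  shows "category (opp C)"
proof -
  interpret category C by fact
  show ?thesis
    by unfold_locales
      (simp_all add: Dom_in Cod_in Id_in Dom_Id Cod_Id Comp_in Dom_Comp Cod_Comp
        Comp_Id_right Comp_Id_left Comp_assoc)
qed

lemma is_functor_opp:
  assumes "is_functor C F D"
  shows "is_functor (opp C) F (opp D)"
proof -
  interpret is_functor C F D by fact
  show ?thesis
    by (intro is_functor.intro category_opp is_functor_axioms.intro)
      (simp_all add: source.category_axioms target.category_axioms
        ob_in ar_in map_Dom map_Cod map_Id map_Comp)
qed

section \<open>Retractions of the fibre over an idempotent\<close>

text \<open>A common interface for both variances. The disjunction in \<open>r_connected\<close>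
  leaves the direction open: a fibration lifts \<open>e\<close> to an arrow from \<open>r a\<close>
  to \<open>a\<close>, an opfibration to one from \<open>a\<close> to \<open>r a\<close>. The two
  cases in \<open>r_arrow\<close> are the images of the two arrows of \<open>e_cat\<close>.\<close>

locale fibre_retraction = is_functor "tot A" "proj A" X
  for A :: "('o, 'a, 'x, 'y) over" and X :: "('x, 'y) cat" +
  fixes x :: 'x and e :: 'y and r :: "'o \<Rightarrow> 'o"
  assumes r_arrow: "\<lbrakk>g \<in> Ar (tot A); ar_map (proj A) g = Id X x \<or> ar_map (proj A) g = e\<rbrakk>
      \<Longrightarrow> r (Dom (tot A) g) = r (Cod (tot A) g)"
    and r_fixed: "\<lbrakk>g \<in> Ar (tot A); ar_map (proj A) g = e; Dom (tot A) g = Cod (tot A) g\<rbrakk>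
      \<Longrightarrow> r (Cod (tot A) g) = Cod (tot A) g"
    and r_connected: "\<lbrakk>a \<in> Ob (tot A); ob_map (proj A) a = x\<rbrakk>
      \<Longrightarrow> \<exists>g \<in> Ar (tot A). ar_map (proj A) g = e \<and>
        (Dom (tot A) g = r a \<and> Cod (tot A) g = a \<or> Dom (tot A) g = a \<and> Cod (tot A) g = r a)"
    and r_loop: "\<lbrakk>a \<in> Ob (tot A); ob_map (proj A) a = x\<rbrakk>
      \<Longrightarrow> \<exists>!g. g \<in> Ar (tot A) \<and> ar_map (proj A) g = e \<and> Dom (tot A) g = r a \<and> Cod (tot A) g = r a"

text \<open>Take \<open>r a\<close> to be the domain of the unique lift of \<open>e\<close> with
  codomain \<open>a\<close>. It is idempotent because a composite of two lifts of \<open>e\<close>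
  lies over \<open>Comp X e e = e\<close> and is again a lift of \<open>e\<close>.\<close>

lemma discrete_fibration_retraction:
  assumes A: "A \<in> discrete_fibrations X"
    and e: "x \<in> Ob X" "e \<in> Ar X" "Dom X e = x" "Cod X e = x" "Comp X e e = e"
  shows "\<exists>r. fibre_retraction A X x e r"
proof -
  interpret is_functor "tot A" "proj A" X
    using A by (simp add: discrete_fibrations_def slice_def)
  let ?lift = "\<lambda>a g. g \<in> Ar (tot A) \<and> Cod (tot A) g = a \<and> ar_map (proj A) g = e"
  have uniq: "g = h" if "g \<in> Ar (tot A)" "h \<in> Ar (tot A)" "Cod (tot A) g = Cod (tot A) h"
    "ar_map (proj A) g = ar_map (proj A) h" for g h
  proof -
    have "Cod X (ar_map (proj A) h) = ob_map (proj A) (Cod (tot A) h)"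
      using map_Cod that(2) by simp
    then have "\<exists>!k. k \<in> Ar (tot A) \<and> Cod (tot A) k = Cod (tot A) h
        \<and> ar_map (proj A) k = ar_map (proj A) h"
      using A that(2) ar_in source.Cod_in by (simp add: discrete_fibrations_def)
    then show ?thesis using that by blast
  qed
  have ex: "\<exists>!g. ?lift a g" if "a \<in> Ob (tot A)" "ob_map (proj A) a = x" for a
    using A that e by (simp add: discrete_fibrations_def)
  define l where "l a = (THE g. ?lift a g)" for a
  have l: "?lift a (l a)" if "a \<in> Ob (tot A)" "ob_map (proj A) a = x" for a
    unfolding l_def by (rule theI'[OF ex[OF that]])
  \<comment> \<open>Consequently the domain of any arrow over \<open>e\<close> is \<open>r\<close>
    of its codomain.\<close>
  have l_eq: "l (Cod (tot A) g) = g" if "g \<in> Ar (tot A)" "ar_map (proj A) g = e" for g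
    using that l[of "Cod (tot A) g"] map_Cod[of g] e source.Cod_in by (intro uniq) auto
  let ?r = "\<lambda>a. Dom (tot A) (l a)"
  have r_e: "?r (Dom (tot A) g) = Dom (tot A) g" if g: "g \<in> Ar (tot A)" "ar_map (proj A) g = e" for g
  proof -
    let ?k = "l (Dom (tot A) g)"
    have k: "?lift (Dom (tot A) g) ?k"
      using that map_Dom[of g] e source.Dom_in by (intro l) auto
    \<comment> \<open>Both sides lie over \<open>e\<close> and have the same codomain. Comparing
      their domains then shows that \<open>Dom (tot A) g\<close> is fixed.\<close>
    then have "Comp (tot A) g ?k = g"
      using g e by (intro uniq) (auto simp: source.Comp_in source.Cod_Comp map_Comp)
    then show ?thesis using source.Dom_Comp[of ?k g] k g by simp
  qed
  have "fibre_retraction A X x e ?r"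
  proof (unfold_locales)
    fix g assume g: "g \<in> Ar (tot A)" "ar_map (proj A) g = Id X x \<or> ar_map (proj A) g = e"
    show "?r (Dom (tot A) g) = ?r (Cod (tot A) g)"
    proof (cases "ar_map (proj A) g = e")
      case True
      then show ?thesis using r_e l_eq g by simp
    next
      case False
      then have "ar_map (proj A) g = Id X x" using g by blast
      \<comment> \<open>The identity at the codomain of \<open>g\<close> is another lift of
        \<open>Id X x\<close>.\<close>
      then have "g = Id (tot A) (Cod (tot A) g)"
        using g(1) map_Cod[of g] e source.Cod_in target.Cod_Id
        by (intro uniq) (auto simp: source.Id_in source.Cod_Id map_Id)
      then show ?thesis using source.Dom_Id[OF source.Cod_in[OF g(1)]] by simp
    qed
  next
    fix g assume "g \<in> Ar (tot A)" "ar_map (proj A) g = e" "Dom (tot A) g = Cod (tot A) g"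
    then show "?r (Cod (tot A) g) = Cod (tot A) g" using l_eq by simp
  next
    fix a assume a: "a \<in> Ob (tot A)" "ob_map (proj A) a = x"
    note la = l[OF a]
    show "\<exists>g \<in> Ar (tot A). ar_map (proj A) g = e \<and>
        (Dom (tot A) g = ?r a \<and> Cod (tot A) g = a \<or> Dom (tot A) g = a \<and> Cod (tot A) g = ?r a)"
      using la by blast
    have "?r a \<in> Ob (tot A)" "ob_map (proj A) (?r a) = x"
      using la map_Dom[of "l a"] e source.Dom_in by auto
    then have "?lift (?r a) (l (?r a))" by (rule l)
    \<comment> \<open>The lift at \<open>r a\<close> is a loop: \<open>r_e\<close> applied to
      \<open>l a\<close> says that its domain is \<open>r a\<close> again.\<close>
    then show "\<exists>!g. g \<in> Ar (tot A) \<and> ar_map (proj A) g = e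
        \<and> Dom (tot A) g = ?r a \<and> Cod (tot A) g = ?r a"
      using r_e la by (intro ex1I[of _ "l (?r a)"]) (auto intro: uniq)
  qed
  then show ?thesis by blast
qed

lemma discrete_opfibration_retraction:
  assumes A: "A \<in> discrete_opfibrations X"
    and e: "x \<in> Ob X" "e \<in> Ar X" "Dom X e = x" "Cod X e = x" "Comp X e e = e"
  shows "\<exists>r. fibre_retraction A X x e r"
proof -
  have fn: "is_functor (tot A) (proj A) X"
    using A by (simp add: discrete_opfibrations_def slice_def)
  let ?A = "\<lparr>tot = opp (tot A), proj = proj A\<rparr>"
  have "?A \<in> discrete_fibrations (opp X)"
    using A is_functor_opp
    by (auto simp: discrete_opfibrations_def discrete_fibrations_def slice_def)
  then obtain r where "fibre_retraction ?A (opp X) x e r"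
    using discrete_fibration_retraction[of ?A "opp X" x e] e by auto
  then interpret r: fibre_retraction ?A "opp X" x e r .
  \<comment> \<open>The same \<open>r\<close> serves: duality only swaps the two sides of
    \<open>r_arrow\<close>, the two disjuncts of \<open>r_connected\<close> and the two ends of a
    loop.\<close>
  have "fibre_retraction A X x e r"
  proof (intro fibre_retraction.intro fn fibre_retraction_axioms.intro)
    fix g assume g: "g \<in> Ar (tot A)"
    show "r (Dom (tot A) g) = r (Cod (tot A) g)"
      if "ar_map (proj A) g = Id X x \<or> ar_map (proj A) g = e"
      using r.r_arrow[of g] g that by simp
    show "r (Cod (tot A) g) = Cod (tot A) g"
      if "ar_map (proj A) g = e" "Dom (tot A) g = Cod (tot A) g"
      using r.r_fixed[of g] g that by simp
  next
    fix a assume a: "a \<in> Ob (tot A)" "ob_map (proj A) a = x"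
    show "\<exists>g \<in> Ar (tot A). ar_map (proj A) g = e \<and>
        (Dom (tot A) g = r a \<and> Cod (tot A) g = a \<or> Dom (tot A) g = a \<and> Cod (tot A) g = r a)"
      using r.r_connected[of a] a by auto
    show "\<exists>!g. g \<in> Ar (tot A) \<and> ar_map (proj A) g = e
        \<and> Dom (tot A) g = r a \<and> Cod (tot A) g = r a"
      using r.r_loop[of a] a by (auto simp: conj_commute)
  qed
  then show ?thesis by blast
qed

section \<open>Functors from the idempotent as representatives of components\<close>

text \<open>Idempotence of \<open>g\<close> comes from uniqueness: its square is again a loop at
  \<open>r a\<close> over \<open>e\<close>, so \<open>r_loop\<close> identifies it with
  \<open>g\<close>.\<close>

lemma (in fibre_retraction) loop_hom:
  assumes e: "is_functor e_cat \<epsilon> X" "x = ob_map \<epsilon> ()" "e = ar_map \<epsilon> E_idem"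
    and g: "g \<in> Ar (tot A)" "ar_map (proj A) g = e" "Dom (tot A) g = r a" "Cod (tot A) g = r a"
    and a: "a \<in> Ob (tot A)" "ob_map (proj A) a = x"
  shows "\<lparr>ob_map = \<lambda>_. r a, ar_map = case_e_arrow (Id (tot A) (r a)) g\<rparr>
    \<in> hom \<lparr>tot = e_cat, proj = \<epsilon>\<rparr> A"
proof -
  have \<epsilon>: "ar_map \<epsilon> E_one = Id X x" "Cod X e = x" "Comp X e e = e"
    using e is_functor_e_cat_iff[OF target.category_axioms, of \<epsilon>] by (auto simp: Let_def)
  have ra: "r a \<in> Ob (tot A)" "ob_map (proj A) (r a) = x"
    using g map_Cod[of g] source.Cod_in[of g] \<epsilon> by auto
  have "Comp (tot A) g g \<in> Ar (tot A) \<and> ar_map (proj A) (Comp (tot A) g g) = e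
      \<and> Dom (tot A) (Comp (tot A) g g) = r a \<and> Cod (tot A) (Comp (tot A) g g) = r a"
    using g \<epsilon> by (simp add: source.Comp_in source.Dom_Comp source.Cod_Comp map_Comp)
  then have "Comp (tot A) g g = g" using r_loop[OF a] g by blast
  then have "is_functor e_cat \<lparr>ob_map = \<lambda>_. r a, ar_map = case_e_arrow (Id (tot A) (r a)) g\<rparr> (tot A)"
    using g ra by (simp add: is_functor_e_cat_iff source.category_axioms)
  \<comment> \<open>Objects and arrows of \<open>e_cat\<close> are \<open>UNIV\<close>, so the
    \<open>extensional\<close> conditions hold for any maps.\<close>
  then show ?thesis
    using g ra \<epsilon> e by (auto simp: hom_def e_cat_def map_Id split: e_arrow.split)
qed

text \<open>\<open>r\<close> takes one value \<open>r a\<close> on the component. A morphism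
  \<open>F\<close> represented there carries a loop over \<open>e\<close>, so its object is fixed by
  \<open>r\<close> and equals \<open>r a\<close>; the loop is then determined by
  \<open>r_loop\<close>. Conversely \<open>r a\<close> lies in the component by
  \<open>r_connected\<close>.\<close>

lemma (in fibre_retraction) unique_representative:
  assumes e: "is_functor e_cat \<epsilon> X" "x = ob_map \<epsilon> ()" "e = ar_map \<epsilon> E_idem"
    and t: "t \<in> ten \<lparr>tot = e_cat, proj = \<epsilon>\<rparr> A"
  shows "\<exists>!F. F \<in> hom \<lparr>tot = e_cat, proj = \<epsilon>\<rparr> A \<and> ((), ob_map F ()) \<in> t"
proof -
  let ?P = "\<lparr>tot = e_cat, proj = \<epsilon>\<rparr>"
  let ?Q = "pullback ?P A"
  have \<epsilon>: "ar_map \<epsilon> E_one = Id X x" "Cod X e = x"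
    using e is_functor_e_cat_iff[OF target.category_axioms, of \<epsilon>] by (auto simp: Let_def)
  from t obtain a where a: "a \<in> Ob (tot A)" "ob_map (proj A) a = x"
    and t_eq: "t = connected_rel ?Q `` {((), a)}"
    using e by (auto simp: ten_def components_def pullback_def elim!: quotientE)
  have r_t: "r b = r a" if "((), b) \<in> t" for b
  proof -
    have "r (snd ((), a)) = r (snd ((), b))"
    proof (rule connected_rel_invariant[where k = "\<lambda>u. r (snd u)"])
      show "(((), a), ((), b)) \<in> connected_rel ?Q" using that t_eq by simp
      fix h assume "h \<in> Ar ?Q"
      then obtain f g where h: "h = (f, g)" and g: "g \<in> Ar (tot A)"
        and fg: "ar_map (proj A) g = ar_map \<epsilon> f"
        by (auto simp: pullback_def)
      from fg have "ar_map (proj A) g = Id X x \<or> ar_map (proj A) g = e"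
        using \<epsilon> e by (cases f) auto
      then show "r (snd (Dom ?Q h)) = r (snd (Cod ?Q h))"
        using r_arrow[OF g] by (simp add: h pullback_def)
    qed
    then show ?thesis by simp
  qed
  have F: "ob_map F () = r a \<and> ar_map F E_one = Id (tot A) (r a)
      \<and> ar_map F E_idem \<in> Ar (tot A) \<and> ar_map (proj A) (ar_map F E_idem) = e
      \<and> Dom (tot A) (ar_map F E_idem) = r a \<and> Cod (tot A) (ar_map F E_idem) = r a"
    if "F \<in> hom ?P A" "((), ob_map F ()) \<in> t" for F
  proof -
    have "is_functor e_cat F (tot A)" using homD(1)[OF that(1)] by simp
    then have *: "ar_map F E_one = Id (tot A) (ob_map F ())" "ar_map F E_idem \<in> Ar (tot A)"
      "Dom (tot A) (ar_map F E_idem) = ob_map F ()" "Cod (tot A) (ar_map F E_idem) = ob_map F ()"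
      by (simp_all add: is_functor_e_cat_iff source.category_axioms Let_def)
    moreover have "ar_map (proj A) (ar_map F E_idem) = e"
      using homD(3)[OF that(1), of E_idem] e by (simp add: e_cat_def)
    ultimately show ?thesis
      using r_fixed[of "ar_map F E_idem"] r_t[OF that(2)] by simp
  qed
  obtain g where g: "g \<in> Ar (tot A)" "ar_map (proj A) g = e"
      "Dom (tot A) g = r a" "Cod (tot A) g = r a"
    using r_loop[OF a] by blast
  let ?F = "\<lparr>ob_map = \<lambda>_. r a, ar_map = case_e_arrow (Id (tot A) (r a)) g\<rparr>"
  show ?thesis
  proof (rule ex1I[of _ ?F])
    obtain k where k: "k \<in> Ar (tot A)" "ar_map (proj A) k = e"
      "Dom (tot A) k = r a \<and> Cod (tot A) k = a \<or> Dom (tot A) k = a \<and> Cod (tot A) k = r a"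
      using r_connected[OF a] by blast
    have ra: "r a \<in> Ob (tot A)" "ob_map (proj A) (r a) = x"
      using g map_Cod[OF g(1)] source.Cod_in[OF g(1)] \<epsilon>(2) by simp_all
    have "(((), a), ((), r a)) \<in> connected_rel ?Q"
    proof -
      \<comment> \<open>Pairing \<open>k\<close> with \<open>E_idem\<close> gives an arrow of the
        pullback that joins \<open>a\<close> and \<open>r a\<close>, in whichever direction
        \<open>k\<close> points.\<close>
      have "(E_idem, k) \<in> Ar ?Q" "((), a) \<in> Ob ?Q" "((), r a) \<in> Ob ?Q"
        using k a ra e by (simp_all add: pullback_def e_cat_def)
      moreover have "Dom ?Q (E_idem, k) = ((), Dom (tot A) k)"
        "Cod ?Q (E_idem, k) = ((), Cod (tot A) k)"
        by (simp_all add: pullback_def)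
      ultimately show ?thesis
        using connected_rel_arrow[of "(E_idem, k)" ?Q] k(3) by (elim disjE conjE) simp_all
    qed
    then show "?F \<in> hom ?P A \<and> ((), ob_map ?F ()) \<in> t"
      using loop_hom[OF e g a] t_eq by simp
    fix F assume asm: "F \<in> hom ?P A \<and> ((), ob_map F ()) \<in> t"
    note F = F[OF conjunct1[OF asm] conjunct2[OF asm]]
    then have "ar_map F E_idem = g" using g r_loop[OF a] by metis
    with F have "ar_map F f = ar_map ?F f" for f by (cases f) simp_all
    with F show "F = ?F" by (intro ftor.equality) (simp_all add: fun_eq_iff)
  qed
qed

section \<open>Idempotents are atoms\<close>

theorem corollary11:
  fixes X :: "('x, 'y) cat" and e :: "(unit, e_arrow, 'x, 'y) ftor"
  assumes "category X"
    and "is_functor e_cat e X"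
  shows "atom TYPE('o) TYPE('a) X \<lparr>tot = e_cat, proj = e\<rparr>"
proof -
  let ?P = "\<lparr>tot = e_cat, proj = e\<rparr>"
  have e: "ob_map e () \<in> Ob X" "ar_map e E_idem \<in> Ar X"
    "Dom X (ar_map e E_idem) = ob_map e ()" "Cod X (ar_map e E_idem) = ob_map e ()"
    "Comp X (ar_map e E_idem) (ar_map e E_idem) = ar_map e E_idem"
    using assms(2) by (simp_all add: is_functor_e_cat_iff[OF assms(1)] Let_def)
  \<comment> \<open>Stated for an arbitrary class \<open>\<A>\<close> of objects with retractions,
    to be used once for fibrations and once for opfibrations.\<close>
  have bij: "\<exists>\<phi>. natural_bijections ?P \<A> \<phi>"
    if retraction: "\<And>A. A \<in> \<A> \<Longrightarrow> \<exists>r. fibre_retraction A X (ob_map e ()) (ar_map e E_idem) r"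
    for \<A> :: "('o, 'a, 'x, 'y) over set"
  proof (rule exI, rule natural_bijections_if_unique_representative[of "()"])
    show "() \<in> Ob (tot ?P)" by (simp add: e_cat_def)
    fix A t assume "A \<in> \<A>" and t: "t \<in> ten ?P A"
    then obtain r where "fibre_retraction A X (ob_map e ()) (ar_map e E_idem) r"
      using retraction by blast
    then show "\<exists>!F. F \<in> hom ?P A \<and> ((), ob_map F ()) \<in> t"
      by (rule fibre_retraction.unique_representative[OF _ assms(2) refl refl t])
  qed
  have "?P \<in> slice X" using assms(2) by (simp add: slice_def)
  then show ?thesis
    unfolding atom_def left_atom_def right_atom_def
    by (intro conjI bij discrete_fibration_retraction[OF _ e]
        discrete_opfibration_retraction[OF _ e])
qed

end
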